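(* Let $(\alpha_n)_{n\ge1}$ be a sequence in $(0,\pi]$ with $\alpha_n\to0$, and let $X^n$ be the interpolated walk (defined in the context) whose angles at stage $n$ are i.i.d. uniform on $[-\alpha_n,\alpha_n]$. (i) If $n\alpha_n^2\to\infty$, then $\frac1n X^n\rightharpoonup 0$ in $C([0,1],\mathbb{R}^2)$ as $n\to\infty$. (ii) If $n\alpha_n^2\to0$, then $\frac1n X^n\rightharpoonup (tU)_{t\in[0,1]}$ in $C([0,1],\mathbb{R}^2)$ as $n\to\infty$, where $U$ is a random vector uniformly distributed on the unit circle $\mathbb{S}^1$.
   Context: $\mathbb{R}^2$ is identified with $\mathbb{C}$; $C([0,1],\mathbb{R}^2)$ carries the uniform topology; $\rightharpoonup$ denotes weak convergence of probability laws. The walk: for each $n\ge1$, $\{\Theta_{j,n}\}_{j\ge2}$ are i.i.d. uniform on $[-\alpha_n,\alpha_n]$, $U_{1,n}$ is uniform on $\mathbb{S}^1$ and independent of $\{\Theta_{j,n}\}_{j\ge2}$, $U_{j,n}=e^{i\Theta_{j,n}}U_{j-1,n}$ for $j\ge2$, and for $t\in[0,1]$, $X^n_t=\sum_{j=1}^{\lfloor nt\rfloor}U_{j,n}+(nt-\lfloor nt\rfloor)U_{\lfloor nt\rfloor+1,n}$. *)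

theory Defs
  imports "HOL-Probability.Probability"
begin

section \<open>Weak convergence of probability laws on a topological space\<close>

definition borel_of :: "'a topology \<Rightarrow> 'a measure" where
  "borel_of T = sigma (topspace T) {S. openin T S}"

definition weak_conv_on :: "'a topology \<Rightarrow> (nat \<Rightarrow> 'a measure) \<Rightarrow> 'a measure \<Rightarrow> bool" where
  "weak_conv_on T \<mu> \<nu> \<longleftrightarrow>
     (\<forall>\<^sub>F n in sequentially. prob_space (\<mu> n) \<and> sets (\<mu> n) = sets (borel_of T)) \<and>
     prob_space \<nu> \<and> sets \<nu> = sets (borel_of T) \<and>
     (\<forall>f. continuous_map T euclideanreal f \<and> bounded (f ` topspace T) \<longrightarrow>
        (\<lambda>n. \<integral>x. f x \<partial>\<mu> n) \<longlonglongrightarrow> (\<integral>x. f x \<partial>\<nu>))"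

text \<open>
  The sequence \<open>X n\<close>, \<open>n \<ge> 1\<close>, may live on varying probability spaces. Measurability of
  \<open>X n\<close> is part of the notion, since \<^const>\<open>distr\<close> is meaningful only for measurable maps.
\<close>
definition converges_in_law ::
    "'b topology \<Rightarrow> (nat \<Rightarrow> 'a measure) \<Rightarrow> (nat \<Rightarrow> 'a \<Rightarrow> 'b) \<Rightarrow> 'b measure \<Rightarrow> bool" where
  "converges_in_law T M X \<nu> \<longleftrightarrow>
     (\<forall>n\<ge>1. X n \<in> M n \<rightarrow>\<^sub>M borel_of T) \<and>
     weak_conv_on T (\<lambda>n. distr (M n) (borel_of T) (X n)) \<nu>"

section \<open>The space of continuous planar paths\<close>

text \<open>
  The elements are continuous functions on \<open>{0..1}\<close> (with the arbitrary value \<open>undefined\<close>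
  outside), and the topology is that of the supremum distance. The plane is the type
  \<^typ>\<open>complex\<close>.
\<close>
definition path_space :: "(real \<Rightarrow> complex) topology" where
  "path_space = mtopology_of (cfunspace (top_of_set {0..1}) euclidean_metric)"

section \<open>The walk\<close>

definition uniform_circle :: "complex measure" where
  "uniform_circle = distr (uniform_measure lborel {0..<2 * pi}) borel cis"

text \<open>
  One stage of the model: \<open>U1\<close> is the initial direction and \<open>\<Theta> j\<close>, \<open>j \<ge> 2\<close>, are the
  turning angles. The last assumption is the independence of the sigma-algebra generated by
  \<open>U1\<close> from the one generated by the whole family of angles.
\<close>
locale uniform_angles = prob_space M
  for M :: "'a measure" and a :: real and U1 :: "'a \<Rightarrow> complex" and \<Theta> :: "nat \<Rightarrow> 'a \<Rightarrow> real" +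
  assumes angles_indep: "indep_vars (\<lambda>_. borel) \<Theta> {2..}"
    and angles_uniform: "\<And>j. j \<ge> 2 \<Longrightarrow> distr M borel (\<Theta> j) = uniform_measure lborel {- a..a}"
    and start_measurable: "U1 \<in> borel_measurable M"
    and start_uniform: "distr M borel U1 = uniform_circle"
    and start_indep_angles:
      "indep_set
         (sets (vimage_algebra (space M) U1 borel))
         (sets (vimage_algebra (space M) (\<lambda>\<omega>. \<lambda>j\<in>{2..}. \<Theta> j \<omega>) (PiM {2..} (\<lambda>_. borel))))"

text \<open>Steps are indexed from 1; the value at index 0 is never used.\<close>
fun walk_step :: "complex \<Rightarrow> (nat \<Rightarrow> real) \<Rightarrow> nat \<Rightarrow> complex" where
  "walk_step u \<theta> 0 = 0"
| "walk_step u \<theta> (Suc 0) = u"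
| "walk_step u \<theta> (Suc (Suc k)) = cis (\<theta> (Suc (Suc k))) * walk_step u \<theta> (Suc k)"

definition walk :: "nat \<Rightarrow> complex \<Rightarrow> (nat \<Rightarrow> real) \<Rightarrow> real \<Rightarrow> complex" where
  "walk n u \<theta> t =
     (\<Sum>j = 1..nat \<lfloor>real n * t\<rfloor>. walk_step u \<theta> j) +
     (real n * t - of_int \<lfloor>real n * t\<rfloor>) *\<^sub>R walk_step u \<theta> (nat \<lfloor>real n * t\<rfloor> + 1)"

end

theory Submission
  imports Defs
begin

text \<open>
  Write \<open>S\<^sub>j\<close> for the unit steps of one stage of the walk and \<open>\<rho> = sin a / a\<close> for the mean of
  \<open>cis \<Theta>\<close> when \<open>\<Theta>\<close> is uniform on \<open>{- a..a}\<close>. The turning angles are independent, so the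
  expected inner product of \<open>S\<^sub>j\<close> and \<open>S\<^sub>k\<close> is \<open>\<rho> ^ \<bar>j - k\<bar>\<close> (lemma
  \<open>expectation_step_inner\<close>), and \<open>1 - \<rho>\<close> is of the order of \<open>a\<^sup>2\<close>. Both regimes follow from
  second moments computed with this single formula.

  If \<open>n a\<^sup>2\<close> is large, the correlations have a range of order \<open>1 / a\<^sup>2\<close>, small compared with \<open>n\<close>;
  for \<open>a \<le> 1\<close>, the second moment of a sum of \<open>n\<close> steps with weights in \<open>{0..1}\<close> is at most
  \<open>20 n / a\<^sup>2\<close>, so the rescaled walk at a fixed time has second moment \<open>O(1 / (n a\<^sup>2))\<close>. The
  rescaled paths are almost surely 1-Lipschitz, so smallness on a finite grid of times gives smallness in the uniform norm.

  If \<open>n a\<^sup>2\<close> is small, all \<open>n\<close> steps stay close to the first one, since the expected square of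
  \<open>norm (S\<^sub>j - S\<^sub>1)\<close> is \<open>2 - 2 \<rho> ^ (j - 1) \<le> n a\<^sup>2 / 3\<close>. The uniform distance between the
  rescaled walk and the ray \<open>t S\<^sub>1\<close> is at most the mean of \<open>norm (S\<^sub>j - S\<^sub>1)\<close> over \<open>j \<le> n\<close>.

  In both regimes the rescaled walk is thus close in probability to a random path with the limit law,
  defined on the same probability space and taking values in a fixed compact set of paths (the zero
  path, or the rays with direction on the unit circle). A continuous function is uniformly
  continuous near a compact set, so this closeness implies convergence in law (lemma
  \<open>converges_in_law_by_coupling\<close>).
\<close>

section \<open>Convergence in law by coupling\<close>

lemma space_borel_of [simp]: "space (borel_of T) = topspace T"
  by (simp add: borel_of_def space_measure_of_conv)

lemma measurable_borel_ofI:
  assumes "X \<in> space M \<rightarrow> topspace T"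
    and "\<And>S. openin T S \<Longrightarrow> X -` S \<inter> space M \<in> sets M"
  shows "X \<in> M \<rightarrow>\<^sub>M borel_of T"
  unfolding borel_of_def
  by (rule measurable_measure_of) (use assms in \<open>auto dest: openin_subset\<close>)

lemma openin_sets_borel_of: "openin T S \<Longrightarrow> S \<in> sets (borel_of T)"
  by (auto simp: borel_of_def sets_measure_of_conv dest: openin_subset)

lemma continuous_map_borel_measurable:
  assumes "continuous_map T euclidean f"
  shows "f \<in> borel_measurable (borel_of T)"
proof (rule borel_measurableI)
  fix S :: "'b set" assume "open S"
  then have "openin T {x \<in> topspace T. f x \<in> S}"
    using openin_continuous_map_preimage[OF assms] by simp
  moreover have "f -` S \<inter> space (borel_of T) = {x \<in> topspace T. f x \<in> S}" by auto
  ultimately show "f -` S \<inter> space (borel_of T) \<in> sets (borel_of T)"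
    by (simp add: openin_sets_borel_of)
qed

lemma continuous_map_euclidean_measurable:
  assumes g: "continuous_map euclidean T g"
  shows "g \<in> borel \<rightarrow>\<^sub>M borel_of T"
proof (rule measurable_borel_ofI)
  show "g \<in> space borel \<rightarrow> topspace T"
    using continuous_map_image_subset_topspace[OF g] by auto
  fix S assume "openin T S"
  from openin_continuous_map_preimage[OF g this] have "open (g -` S)"
    by (simp add: vimage_def)
  then show "g -` S \<inter> space borel \<in> sets borel" by simp
qed

text \<open>
  Only one of the two points has to lie in the compact set. That is what makes plain continuity
  of the test function enough for the weak convergence below.
\<close>
lemma (in Metric_space) continuous_map_uniform_near_compact:
  fixes f :: "'a \<Rightarrow> real"
  assumes f: "continuous_map mtopology euclidean f"
    and K: "compactin mtopology K" and "0 < \<epsilon>"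
  obtains \<delta> where "0 < \<delta>"
    "\<And>z y. z \<in> K \<Longrightarrow> y \<in> M \<Longrightarrow> d z y < \<delta> \<Longrightarrow> \<bar>f y - f z\<bar> < \<epsilon>"
proof -
  have KM: "K \<subseteq> M" using K compactin_subset_topspace by fastforce
  \<comment> \<open>A finite subcover by balls of half the radius leaves room for a point near \<open>z\<close>.\<close>
  have "\<exists>r>0. \<forall>y\<in>mball z (2 * r). \<bar>f y - f z\<bar> < \<epsilon> / 2" if "z \<in> K" for z
  proof -
    have "openin mtopology {x \<in> M. f x \<in> ball (f z) (\<epsilon> / 2)}"
      using openin_continuous_map_preimage[OF f, of "ball (f z) (\<epsilon> / 2)"] by simp
    moreover have "z \<in> {x \<in> M. f x \<in> ball (f z) (\<epsilon> / 2)}"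
      using that KM \<open>0 < \<epsilon>\<close> by auto
    ultimately obtain r where "r > 0" and r: "mball z r \<subseteq> {x \<in> M. f x \<in> ball (f z) (\<epsilon> / 2)}"
      unfolding openin_mtopology by blast
    have "\<forall>y\<in>mball z (2 * (r / 2)). \<bar>f y - f z\<bar> < \<epsilon> / 2"
      using r by (auto simp: dist_real_def abs_minus_commute)
    with \<open>r > 0\<close> show ?thesis by (intro exI[of _ "r / 2"]) auto
  qed
  then obtain R where R: "\<And>z. z \<in> K \<Longrightarrow> R z > 0"
    and fR: "\<And>z y. z \<in> K \<Longrightarrow> y \<in> mball z (2 * R z) \<Longrightarrow> \<bar>f y - f z\<bar> < \<epsilon> / 2"
    by metis
  have "z \<in> mball z (R z)" if "z \<in> K" for z using R[OF that] that KM by auto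
  then have "K \<subseteq> \<Union>((\<lambda>z. mball z (R z)) ` K)" by blast
  moreover have "openin mtopology U" if "U \<in> (\<lambda>z. mball z (R z)) ` K" for U
    using that by auto
  ultimately obtain \<F> where \<F>: "finite \<F>" "\<F> \<subseteq> (\<lambda>z. mball z (R z)) ` K" "K \<subseteq> \<Union>\<F>"
    using compactinD[OF K, of "(\<lambda>z. mball z (R z)) ` K"] by blast
  obtain C where C: "C \<subseteq> K" "finite C" "\<F> = (\<lambda>z. mball z (R z)) ` C"
    using finite_subset_image[OF \<F>(1,2)] by blast
  with \<F>(3) have cover: "K \<subseteq> (\<Union>z\<in>C. mball z (R z))" by simp
  define \<delta> where "\<delta> = Min (insert 1 (R ` C))"
  show thesis
  proof
    show "0 < \<delta>" using C R by (auto simp: \<delta>_def)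
    fix z y assume z: "z \<in> K" and y: "y \<in> M" and zy: "d z y < \<delta>"
    obtain c where c: "c \<in> C" "d c z < R c" using cover z by auto
    have cM: "c \<in> K" "c \<in> M" "z \<in> M" using c C KM z by auto
    have "\<delta> \<le> R c" unfolding \<delta>_def using c C by (intro Min_le) auto
    with zy c have "d c y < 2 * R c" using triangle[of c z y] cM y by auto
    then have "\<bar>f y - f c\<bar> < \<epsilon> / 2" using fR[OF cM(1)] cM y by auto
    moreover have "\<bar>f z - f c\<bar> < \<epsilon> / 2"
      using fR[OF cM(1)] cM c R[OF cM(1)] by auto
    ultimately show "\<bar>f y - f z\<bar> < \<epsilon>" by linarith
  qed
qed

text \<open>
  Off the exceptional event the difference is at most \<open>\<epsilon>\<close>; on it, at most twice the bound.
\<close>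
lemma (in prob_space) expectation_diff_le:
  fixes f g :: "'a \<Rightarrow> real"
  assumes [measurable]: "f \<in> borel_measurable M" "g \<in> borel_measurable M" "B \<in> sets M"
    and f: "\<And>\<omega>. \<omega> \<in> space M \<Longrightarrow> \<bar>f \<omega>\<bar> \<le> C"
    and g: "\<And>\<omega>. \<omega> \<in> space M \<Longrightarrow> \<bar>g \<omega>\<bar> \<le> C"
    and close: "AE \<omega> in M. \<omega> \<notin> B \<longrightarrow> \<bar>f \<omega> - g \<omega>\<bar> \<le> \<epsilon>"
    and "0 \<le> \<epsilon>"
  shows "\<bar>expectation f - expectation g\<bar> \<le> \<epsilon> + 2 * C * prob B"
proof -
  have int: "integrable M f" "integrable M g"
    using f g by (auto intro!: integrable_const_bound[where B = C] AE_I2)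
  have int_B: "integrable M (\<lambda>\<omega>. 2 * C * indicator B \<omega>)"
    by (intro integrable_mult_right integrable_real_indicator) (auto simp: emeasure_eq_measure)
  have "\<bar>expectation f - expectation g\<bar> = \<bar>expectation (\<lambda>\<omega>. f \<omega> - g \<omega>)\<bar>"
    using int by simp
  also have "\<dots> \<le> expectation (\<lambda>\<omega>. \<bar>f \<omega> - g \<omega>\<bar>)" by (rule integral_abs_bound)
  also have "\<dots> \<le> expectation (\<lambda>\<omega>. \<epsilon> + 2 * C * indicator B \<omega>)"
  proof (rule integral_mono_AE)
    show "integrable M (\<lambda>\<omega>. \<bar>f \<omega> - g \<omega>\<bar>)" using int by auto
    show "integrable M (\<lambda>\<omega>. \<epsilon> + 2 * C * indicator B \<omega>)"
      using int_B by (intro Bochner_Integration.integrable_add integrable_const)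
    show "AE \<omega> in M. \<bar>f \<omega> - g \<omega>\<bar> \<le> \<epsilon> + 2 * C * indicator B \<omega>"
      using close AE_space
    proof eventually_elim
      case (elim \<omega>)
      with f[of \<omega>] g[of \<omega>] \<open>0 \<le> \<epsilon>\<close> show ?case by (auto simp: indicator_def)
    qed
  qed
  also have "\<dots> = \<epsilon> + 2 * C * prob B"
    using int_B by (subst Bochner_Integration.integral_add) (simp_all add: prob_space)
  finally show ?thesis .
qed

text \<open>
  For a bounded continuous \<open>f\<close>, the difference of \<open>f (Y n)\<close> and \<open>f (Z n)\<close> is small off an event
  of small probability, while the law of \<open>Z n\<close> is the limit itself. Closeness is expressed through
  exceptional events \<open>B n\<close> because in a non-separable space the distance of two measurable maps need
  not be measurable.
\<close>
lemma converges_in_law_by_coupling: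
  fixes m :: "'b metric" and M :: "nat \<Rightarrow> 'a measure"
  assumes M: "\<And>n. n \<ge> 1 \<Longrightarrow> prob_space (M n)"
    and Y: "\<And>n. n \<ge> 1 \<Longrightarrow> Y n \<in> M n \<rightarrow>\<^sub>M borel_of (mtopology_of m)"
    and Z: "\<And>n. n \<ge> 1 \<Longrightarrow> Z n \<in> M n \<rightarrow>\<^sub>M borel_of (mtopology_of m)"
    and law: "\<And>n. n \<ge> 1 \<Longrightarrow> distr (M n) (borel_of (mtopology_of m)) (Z n) = \<nu>"
    and K: "compactin (mtopology_of m) K"
    and ZK: "\<And>n. n \<ge> 1 \<Longrightarrow> AE \<omega> in M n. Z n \<omega> \<in> K"
    and close: "\<And>\<epsilon>::real. 0 < \<epsilon> \<Longrightarrow> \<exists>B. (\<forall>n\<ge>1. B n \<in> sets (M n) \<and>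
        (AE \<omega> in M n. \<omega> \<notin> B n \<longrightarrow> mdist m (Z n \<omega>) (Y n \<omega>) < \<epsilon>)) \<and>
        (\<lambda>n. measure (M n) (B n)) \<longlonglongrightarrow> 0"
  shows "converges_in_law (mtopology_of m) M Y \<nu>"
  unfolding converges_in_law_def weak_conv_on_def
proof (intro conjI allI impI)
  let ?T = "mtopology_of m"
  interpret m: Metric_space "mspace m" "mdist m" by simp
  have T: "?T = m.mtopology" by (simp add: mtopology_of_def)
  show "Y n \<in> M n \<rightarrow>\<^sub>M borel_of ?T" if "1 \<le> n" for n using Y that by simp
  show "\<forall>\<^sub>F n in sequentially. prob_space (distr (M n) (borel_of ?T) (Y n)) \<and>
      sets (distr (M n) (borel_of ?T) (Y n)) = sets (borel_of ?T)"
    using eventually_ge_at_top[of 1] by eventually_elim (use M Y in \<open>auto intro: prob_space.prob_space_distr\<close>)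
  show "prob_space \<nu>" "sets \<nu> = sets (borel_of ?T)"
    using law[of 1] M[of 1] Z[of 1] by (auto intro: prob_space.prob_space_distr)
  fix f :: "'b \<Rightarrow> real"
  assume "continuous_map ?T euclideanreal f \<and> bounded (f ` topspace ?T)"
  then have f: "continuous_map ?T euclideanreal f" and "bounded (f ` topspace ?T)" by auto
  then obtain C where C: "C > 0" "\<And>x. x \<in> topspace ?T \<Longrightarrow> \<bar>f x\<bar> \<le> C"
    by (auto simp: bounded_pos)
  have fm: "f \<in> borel_measurable (borel_of ?T)"
    by (rule continuous_map_borel_measurable[OF f])
  have EY: "(\<integral>x. f x \<partial>distr (M n) (borel_of ?T) (Y n)) = (\<integral>\<omega>. f (Y n \<omega>) \<partial>M n)" if "n \<ge> 1" for n
    using Y[OF that] fm by (rule integral_distr)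
  have EZ: "(\<integral>x. f x \<partial>\<nu>) = (\<integral>\<omega>. f (Z n \<omega>) \<partial>M n)" if "n \<ge> 1" for n
    using integral_distr[OF Z[OF that] fm] law[OF that] by simp
  show "(\<lambda>n. \<integral>x. f x \<partial>distr (M n) (borel_of ?T) (Y n)) \<longlonglongrightarrow> (\<integral>x. f x \<partial>\<nu>)"
  proof (rule tendstoI)
    fix \<epsilon> :: real assume "0 < \<epsilon>"
    then have "0 < \<epsilon> / 2" by simp
    obtain \<delta> where "0 < \<delta>" and \<delta>: "\<And>z y. z \<in> K \<Longrightarrow> y \<in> mspace m \<Longrightarrow> mdist m z y < \<delta> \<Longrightarrow> \<bar>f y - f z\<bar> < \<epsilon> / 2"
      using m.continuous_map_uniform_near_compact[OF f[unfolded T] K[unfolded T] \<open>0 < \<epsilon> / 2\<close>] by blast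
    obtain B where B: "\<And>n. n \<ge> 1 \<Longrightarrow> B n \<in> sets (M n)"
      and near: "\<And>n. n \<ge> 1 \<Longrightarrow> AE \<omega> in M n. \<omega> \<notin> B n \<longrightarrow> mdist m (Z n \<omega>) (Y n \<omega>) < \<delta>"
      and B0: "(\<lambda>n. measure (M n) (B n)) \<longlonglongrightarrow> 0"
      using close[OF \<open>0 < \<delta>\<close>] by blast
    have "(\<lambda>n. \<epsilon> / 2 + 2 * C * measure (M n) (B n)) \<longlonglongrightarrow> \<epsilon> / 2 + 2 * C * 0"
      by (intro tendsto_intros B0)
    then have "\<forall>\<^sub>F n in sequentially. \<epsilon> / 2 + 2 * C * measure (M n) (B n) < \<epsilon>"
      by (rule order_tendstoD) (use \<open>0 < \<epsilon>\<close> in auto)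
    then show "\<forall>\<^sub>F n in sequentially.
        dist (\<integral>x. f x \<partial>distr (M n) (borel_of ?T) (Y n)) (\<integral>x. f x \<partial>\<nu>) < \<epsilon>"
      using eventually_ge_at_top[of 1]
    proof eventually_elim
      case (elim n)
      then have n: "n \<ge> 1" by simp
      interpret prob_space "M n" using M n by simp
      have YT: "Y n \<omega> \<in> mspace m" and ZT: "Z n \<omega> \<in> mspace m" if "\<omega> \<in> space (M n)" for \<omega>
        using measurable_space[OF Y[OF n] that] measurable_space[OF Z[OF n] that] by auto
      have "\<bar>expectation (\<lambda>\<omega>. f (Y n \<omega>)) - expectation (\<lambda>\<omega>. f (Z n \<omega>))\<bar>
          \<le> \<epsilon> / 2 + 2 * C * prob (B n)"
      proof (rule expectation_diff_le)
        show "(\<lambda>\<omega>. f (Y n \<omega>)) \<in> borel_measurable (M n)" "(\<lambda>\<omega>. f (Z n \<omega>)) \<in> borel_measurable (M n)"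
          using measurable_compose[OF Y[OF n] fm] measurable_compose[OF Z[OF n] fm] by simp_all
        show "AE \<omega> in M n. \<omega> \<notin> B n \<longrightarrow> \<bar>f (Y n \<omega>) - f (Z n \<omega>)\<bar> \<le> \<epsilon> / 2"
          using near[OF n] ZK[OF n] AE_space
        proof eventually_elim
          case (elim \<omega>)
          then show ?case using \<delta>[of "Z n \<omega>" "Y n \<omega>"] YT[of \<omega>] by auto
        qed
      qed (use YT ZT C B n \<open>0 < \<epsilon>\<close> in auto)
      with elim show ?case by (simp add: EY EZ[OF n] n dist_real_def)
    qed
  qed
qed

section \<open>Polygonal paths\<close>

definition path_metric :: "(real \<Rightarrow> complex) metric" where
  "path_metric = cfunspace (top_of_set {0..1}) euclidean_metric"

lemma path_space_eq: "path_space = mtopology_of path_metric"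
  by (simp add: path_space_def path_metric_def)

lemma mspace_path_metric:
  "mspace path_metric = {f \<in> extensional {0..1}. continuous_on {0..1} f}"
proof -
  have "compactin (top_of_set {0..1::real}) (topspace (top_of_set {0..1}))"
    by (simp add: compactin_subtopology)
  from compactin_mspace_cfunspace[OF this, of euclidean_metric] show ?thesis
    by (auto simp: path_metric_def continuous_map_iff_continuous)
qed

lemma mdist_path_metric_le:
  assumes "0 \<le> B" "\<And>t. t \<in> {0..1} \<Longrightarrow> norm (f t - g t) \<le> B"
  shows "mdist path_metric f g \<le> B"
  unfolding path_metric_def
  by (rule mdist_cfunspace_le) (use assms in \<open>auto simp: dist_norm\<close>)

text \<open>
  The fraction of the \<open>j\<close>-th step that has been completed at time \<open>t\<close>. With these weights the
  interpolated walk becomes a finite linear combination of its steps, without floors.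
\<close>
definition ramp :: "nat \<Rightarrow> nat \<Rightarrow> real \<Rightarrow> real" where
  "ramp n j t = max 0 (min 1 (real n * t - (real j - 1)))"

definition polyline :: "nat \<Rightarrow> (nat \<Rightarrow> complex) \<Rightarrow> real \<Rightarrow> complex" where
  "polyline n x = (\<lambda>t\<in>{0..1}. (1 / real n) *\<^sub>R (\<Sum>j = 1..n. ramp n j t *\<^sub>R x j))"

lemma ramp_bounds: "0 \<le> ramp n j t" "ramp n j t \<le> 1"
  by (auto simp: ramp_def)

lemma ramp_mono: "s \<le> t \<Longrightarrow> ramp n j s \<le> ramp n j t"
  unfolding ramp_def by (intro max.mono min.mono diff_right_mono mult_left_mono) auto

text \<open>
  Steps up to \<open>\<lfloor>n t\<rfloor>\<close> have weight 1, the following one has the fractional part of \<open>n t\<close> as its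
  weight, and the later ones have weight 0.
\<close>
lemma sum_ramp_scaleR:
  fixes x :: "nat \<Rightarrow> 'a::real_vector"
  assumes t: "0 \<le> t" "t \<le> 1"
  shows "(\<Sum>j = 1..n. ramp n j t *\<^sub>R x j) =
    (\<Sum>j = 1..nat \<lfloor>real n * t\<rfloor>. x j)
      + (real n * t - of_int \<lfloor>real n * t\<rfloor>) *\<^sub>R x (nat \<lfloor>real n * t\<rfloor> + 1)"
proof -
  define m where "m = nat \<lfloor>real n * t\<rfloor>"
  have nt: "0 \<le> real n * t" "real n * t \<le> real n"
    using t by (auto intro: mult_left_le)
  then have m: "real m \<le> real n * t" "real n * t < real m + 1"
    and m_floor: "real m = of_int \<lfloor>real n * t\<rfloor>" by (auto simp: m_def)
  have "m \<le> n" using m nt by linarith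
  have one: "ramp n j t = 1" if "j \<le> m" for j using that m by (auto simp: ramp_def)
  have mid: "ramp n (m + 1) t = real n * t - real m" using m by (auto simp: ramp_def)
  have zero: "ramp n j t = 0" if "j > m + 1" for j using that m by (auto simp: ramp_def)
  \<comment> \<open>For \<open>t = 1\<close> the partial step has index \<open>n + 1\<close>, where the weight vanishes.\<close>
  have "(\<Sum>j = 1..n. ramp n j t *\<^sub>R x j) = (\<Sum>j = 1..n+1. ramp n j t *\<^sub>R x j)"
    using nt by (simp add: ramp_def)
  also have "\<dots> = (\<Sum>j = 1..m+1. ramp n j t *\<^sub>R x j)"
    by (rule sum.mono_neutral_right) (use \<open>m \<le> n\<close> zero in auto)
  also have "\<dots> = (\<Sum>j = 1..m. x j) + (real n * t - real m) *\<^sub>R x (m + 1)"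
    using mid one by simp
  finally show ?thesis by (simp add: m_floor flip: m_def)
qed

lemma sum_ramp:
  assumes "0 \<le> t" "t \<le> 1"
  shows "(\<Sum>j = 1..n. ramp n j t) = real n * t"
  using sum_ramp_scaleR[OF assms, of n "\<lambda>_. 1::real"] assms by simp

lemma rescaled_walk_eq_polyline:
  "(\<lambda>t\<in>{0..1}. (1 / real n) *\<^sub>R walk n u \<theta> t) = polyline n (walk_step u \<theta>)"
  unfolding polyline_def walk_def by (intro restrict_ext) (simp add: sum_ramp_scaleR del: One_nat_def)

lemma polyline_const:
  assumes "n \<ge> 1"
  shows "polyline n (\<lambda>_. u) = (\<lambda>t\<in>{0..1}. t *\<^sub>R u)"
  unfolding polyline_def
  by (intro restrict_ext)
    (use assms in \<open>simp add: sum_ramp del: One_nat_def flip: scaleR_left.sum\<close>)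

lemma polyline_in_mspace: "polyline n x \<in> mspace path_metric"
  unfolding mspace_path_metric polyline_def
  by (auto simp: ramp_def cong: continuous_on_cong_simp intro!: continuous_intros)

lemma mdist_polyline_le:
  "mdist path_metric (polyline n x) (polyline n y) \<le> (\<Sum>j = 1..n. norm (x j - y j)) / real n"
proof (rule mdist_path_metric_le)
  show "0 \<le> (\<Sum>j = 1..n. norm (x j - y j)) / real n" by (simp add: sum_nonneg)
  fix t :: real assume t: "t \<in> {0..1}"
  have "polyline n x t - polyline n y t = (1 / real n) *\<^sub>R (\<Sum>j = 1..n. ramp n j t *\<^sub>R (x j - y j))"
    using t by (simp add: polyline_def scaleR_diff_right sum_subtractf)
  also have "norm \<dots> \<le> (1 / real n) * (\<Sum>j = 1..n. norm (x j - y j))"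
    unfolding norm_scaleR
    by (intro mult_mono order.trans[OF norm_sum] sum_mono)
      (auto intro!: mult_left_le_one_le simp: ramp_bounds)
  finally show "norm (polyline n x t - polyline n y t) \<le> (\<Sum>j = 1..n. norm (x j - y j)) / real n"
    by simp
qed

text \<open>
  Measurability of the random paths rests on this continuity: the sequence space on the left is
  second countable, so a random sequence of steps is Borel measurable as soon as its coordinates are.
\<close>
lemma continuous_map_polyline: "continuous_map euclidean path_space (polyline n)"
proof -
  interpret m: Metric_space "mspace path_metric" "mdist path_metric" by simp
  have "continuous_map euclidean m.mtopology (polyline n)"
    unfolding m.continuous_map_to_metric
  proof (intro ballI allI impI)
    fix x :: "nat \<Rightarrow> complex" and \<epsilon> :: real assume "0 < \<epsilon>"
    let ?U = "{y. (\<Sum>j = 1..n. norm (x j - y j)) / real n < \<epsilon>}"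
    have "open ?U"
      unfolding divide_inverse by (intro open_Collect_less continuous_intros) simp_all
    moreover have "polyline n y \<in> m.mball (polyline n x) \<epsilon>" if "y \<in> ?U" for y
      using that mdist_polyline_le[of n x y] by (auto simp: polyline_in_mspace)
    ultimately show "\<exists>U. openin euclidean U \<and> x \<in> U \<and> (\<forall>y\<in>U. polyline n y \<in> m.mball (polyline n x) \<epsilon>)"
      using \<open>0 < \<epsilon>\<close> by (intro exI[of _ ?U]) auto
  qed
  then show ?thesis by (simp add: path_space_eq mtopology_of_def)
qed

lemma continuous_map_ray: "continuous_map euclidean path_space (\<lambda>u. \<lambda>t\<in>{0..1}. t *\<^sub>R u)"
proof -
  have "continuous_map euclidean euclidean (\<lambda>(u::complex) (_::nat). u)"
    by (simp add: continuous_on_coordinatewise_then_product)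
  from continuous_map_compose[OF this continuous_map_polyline[of 1]] show ?thesis
    by (simp add: o_def polyline_const)
qed

text \<open>
  The increments of the weights are nonnegative and sum to \<open>n (t - s)\<close>.
\<close>
lemma polyline_lipschitz:
  assumes x: "\<And>j. j \<in> {1..n} \<Longrightarrow> norm (x j) \<le> 1"
    and st: "0 \<le> s" "s \<le> t" "t \<le> 1"
  shows "norm (polyline n x t - polyline n x s) \<le> t - s"
proof (cases "n = 0")
  case False
  have "polyline n x t - polyline n x s =
      (1 / real n) *\<^sub>R (\<Sum>j = 1..n. (ramp n j t - ramp n j s) *\<^sub>R x j)"
    using st by (simp add: polyline_def scaleR_diff_left scaleR_diff_right sum_subtractf)
  also have "norm \<dots> \<le> (1 / real n) * (\<Sum>j = 1..n. ramp n j t - ramp n j s)"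
    unfolding norm_scaleR
    by (intro mult_mono order.trans[OF norm_sum] sum_mono)
      (use x st in \<open>auto simp: ramp_mono intro!: mult_left_le sum_nonneg\<close>)
  also have "\<dots> = t - s"
    using st False by (simp add: sum_subtractf sum_ramp del: One_nat_def flip: right_diff_distrib)
  finally show ?thesis .
qed (use st in \<open>simp add: polyline_def\<close>)

text \<open>
  Each time is within \<open>1 / m\<close> of a grid point, and the path is 1-Lipschitz.
\<close>
lemma mdist_zero_polyline_le:
  assumes x: "\<And>j. j \<in> {1..n} \<Longrightarrow> norm (x j) \<le> 1" and "m > 0"
    and grid: "\<And>i. i \<le> m \<Longrightarrow> norm (polyline n x (real i / real m)) \<le> \<epsilon>"
  shows "mdist path_metric (\<lambda>t\<in>{0..1}. 0) (polyline n x) \<le> \<epsilon> + 1 / real m"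
proof (rule mdist_path_metric_le)
  have "0 \<le> \<epsilon>" using grid[of 0] norm_ge_zero order.trans by blast
  then show "0 \<le> \<epsilon> + 1 / real m" by simp
  fix t :: real assume t: "t \<in> {0..1}"
  define i where "i = nat \<lfloor>real m * t\<rfloor>"
  have mt: "0 \<le> real m * t" "real m * t \<le> real m" using t by (auto intro: mult_left_le)
  then have i: "real i \<le> real m * t" "real m * t < real i + 1" by (auto simp: i_def)
  have "i \<le> m" using i mt by linarith
  have it: "real i / real m \<le> t" "t \<le> real i / real m + 1 / real m"
    using i \<open>m > 0\<close> by (auto simp: field_simps)
  have "norm (polyline n x t - polyline n x (real i / real m)) \<le> t - real i / real m"
    by (rule polyline_lipschitz) (use x t it in auto)
  moreover have "norm (polyline n x t) \<le> norm (polyline n x (real i / real m))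
      + norm (polyline n x t - polyline n x (real i / real m))"
    by (metis add.commute diff_add_cancel norm_triangle_ineq)
  ultimately show "norm ((\<lambda>t\<in>{0..1}. 0) t - polyline n x t) \<le> \<epsilon> + 1 / real m"
    using it t grid[OF \<open>i \<le> m\<close>] by simp
qed

section \<open>Unit steps, sines and geometric sums\<close>

lemma norm_walk_step: "norm (walk_step u \<theta> (Suc k)) = norm u"
  by (induction k) (auto simp: norm_mult)

lemma walk_step_add:
  assumes "j \<ge> 1"
  shows "walk_step u \<theta> (j + m) = (\<Prod>l\<in>{j<..j + m}. cis (\<theta> l)) * walk_step u \<theta> j"
proof (induction m)
  case (Suc m)
  obtain i where i: "j + m = Suc i" using assms by (cases "j + m") auto
  have "{j<..j + Suc m} = insert (j + Suc m) {j<..j + m}" by auto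
  then show ?case using Suc i by (simp add: mult.assoc)
qed simp

lemma borel_measurable_cis [measurable]: "cis \<in> borel_measurable borel"
  by (intro borel_measurable_continuous_onI continuous_intros)

lemma integral_cis_symmetric_uniform:
  assumes "0 < a"
  shows "(\<integral>x. cis x \<partial>uniform_measure lborel {- a..a}) = complex_of_real (sin a / a)"
proof -
  have int: "(\<integral>x. indicator {- a..a} x *\<^sub>R cis x \<partial>lborel) = - \<i> * cis a - (- \<i> * cis (- a))"
  proof (rule integral_FTC_atLeastAtMost)
    show "((\<lambda>x. - \<i> * cis x) has_vector_derivative cis x) (at x within {- a..a})" for x
      unfolding has_vector_derivative_def
      by (auto intro!: derivative_eq_intros simp: algebra_simps)
  qed (use assms in \<open>auto intro!: continuous_intros\<close>)
  have "uniform_measure lborel {- a..a} = density lborel (\<lambda>x. ennreal (indicator {- a..a} x / (2 * a)))"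
    unfolding uniform_measure_def
    by (intro density_cong AE_I2)
      (use assms in \<open>auto simp: indicator_def divide_ennreal simp flip: ennreal_1\<close>)
  then have "(\<integral>x. cis x \<partial>uniform_measure lborel {- a..a})
      = (\<integral>x. (indicator {- a..a} x / (2 * a)) *\<^sub>R cis x \<partial>lborel)"
    using assms by (simp add: integral_density)
  also have "\<dots> = (1 / (2 * a)) *\<^sub>R (\<integral>x. indicator {- a..a} x *\<^sub>R cis x \<partial>lborel)"
    by (simp flip: integral_scaleR_right)
  also have "\<dots> = complex_of_real (sin a / a)"
    unfolding int using assms by (simp add: complex_eq_iff)
  finally show ?thesis .
qed

text \<open>
  The Taylor bounds of order 3 and 5 for the sine. The constant \<open>1 / 10\<close> is not optimal:
  \<open>1 / 6 - 1 / 120\<close> would do.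
\<close>
lemma sinc_bounds:
  fixes a :: real
  assumes "0 < a" "a \<le> pi"
  shows "0 \<le> sin a / a" "sin a / a \<le> 1" "1 - sin a / a \<le> a\<^sup>2 / 6"
    and "a \<le> 1 \<Longrightarrow> a\<^sup>2 / 10 \<le> 1 - sin a / a"
proof -
  show "0 \<le> sin a / a" using assms by (simp add: sin_ge_zero)
  show "sin a / a \<le> 1" using sin_x_le_x assms by simp
  show "1 - sin a / a \<le> a\<^sup>2 / 6"
  proof -
    have "\<bar>sin a - a\<bar> \<le> a ^ 3 / 6"
      using Maclaurin_sin_bound[of a 3] assms by (simp add: eval_nat_numeral sin_coeff_def)
    then have "a - a ^ 3 / 6 \<le> sin a" by linarith
    then show ?thesis using assms by (simp add: field_simps power2_eq_square power3_eq_cube)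
  qed
  assume "a \<le> 1"
  have "sin a \<le> a - a ^ 3 / 6 + a ^ 5 / 120"
  proof -
    have "\<bar>sin a - (a - a ^ 3 / 6)\<bar> \<le> a ^ 5 / 120"
      using Maclaurin_sin_bound[of a 5] assms
      by (simp add: lessThan_nat_numeral lessThan_Suc sin_coeff_def fact_numeral)
    then show ?thesis by linarith
  qed
  moreover have "a ^ 5 \<le> a ^ 3"
    using assms \<open>a \<le> 1\<close> by (intro power_decreasing) auto
  moreover have "0 \<le> a ^ 3" using assms by simp
  ultimately have "sin a \<le> a - a ^ 3 / 10" by linarith
  then show "a\<^sup>2 / 10 \<le> 1 - sin a / a"
    using assms by (simp add: field_simps power2_eq_square power3_eq_cube)
qed

lemma AE_uniform_circle: "AE u in uniform_circle. norm u = 1"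
proof -
  show ?thesis unfolding uniform_circle_def
    by (subst AE_distr_iff) auto
qed

lemma borel_measurable_cnj [measurable]: "cnj \<in> borel_measurable borel"
  by (intro borel_measurable_continuous_onI continuous_intros)

text \<open>
  Distinct exponents make the sum a part of the geometric series.
\<close>
lemma sum_power_inj_on_le:
  fixes \<rho> :: real
  assumes "0 \<le> \<rho>" "\<rho> < 1" "finite A" "inj_on g A"
  shows "(\<Sum>k\<in>A. \<rho> ^ g k) \<le> 1 / (1 - \<rho>)"
proof -
  have "(\<Sum>k\<in>A. \<rho> ^ g k) = (\<Sum>i\<in>g ` A. \<rho> ^ i)" using assms by (simp add: sum.reindex)
  also have "\<dots> \<le> (\<Sum>i. \<rho> ^ i)"
    by (rule sum_le_suminf) (use assms in auto)
  also have "\<dots> = 1 / (1 - \<rho>)" using assms by (intro suminf_geometric) auto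
  finally show ?thesis .
qed

lemma sum_power_distance_le:
  fixes \<rho> :: real
  assumes "0 \<le> \<rho>" "\<rho> < 1"
  shows "(\<Sum>k = 1..n. \<rho> ^ (j - k + (k - j))) \<le> 2 / (1 - \<rho>)"
proof -
  have "(\<Sum>k = 1..n. \<rho> ^ (j - k + (k - j)))
      = (\<Sum>k\<in>{1..n} \<inter> {..j}. \<rho> ^ (j - k)) + (\<Sum>k\<in>{1..n} - {..j}. \<rho> ^ (k - j))"
    by (subst sum.Int_Diff[of _ _ "{..j}"]) (auto intro!: arg_cong2[where f = "(+)"] sum.cong)
  also have "\<dots> \<le> 1 / (1 - \<rho>) + 1 / (1 - \<rho>)"
    using assms by (intro add_mono sum_power_inj_on_le) (auto simp: inj_on_def)
  finally show ?thesis by simp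
qed

section \<open>Second moments of the walk\<close>

context uniform_angles
begin

abbreviation step :: "nat \<Rightarrow> 'a \<Rightarrow> complex" where
  "step j \<omega> \<equiv> walk_step (U1 \<omega>) (\<lambda>i. \<Theta> i \<omega>) j"

lemma measurable_angle: "j \<ge> 2 \<Longrightarrow> \<Theta> j \<in> borel_measurable M"
  using angles_indep by (auto simp: indep_vars_def)

lemma measurable_step [measurable]: "step j \<in> borel_measurable M"
proof (induction j rule: induct_nat_012)
  case 1
  then show ?case using start_measurable by simp
next
  case (ge2 j)
  note ge2 [measurable] measurable_angle[of "Suc (Suc j)", measurable]
  show ?case by simp
qed simp

lemma AE_norm_start: "AE \<omega> in M. norm (U1 \<omega>) = 1"
  using AE_uniform_circle unfolding start_uniform[symmetric]
  by (subst (asm) AE_distr_iff) (use start_measurable in auto)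

lemma AE_norm_step: "AE \<omega> in M. \<forall>j\<ge>1. norm (step j \<omega>) = 1"
  using AE_norm_start
proof eventually_elim
  case (elim \<omega>)
  show ?case
  proof (intro allI impI)
    fix j :: nat assume "1 \<le> j"
    then show "norm (step j \<omega>) = 1" using elim norm_walk_step by (cases j) auto
  qed
qed

text \<open>
  Since \<open>cnj\<close> inverts unit vectors, the product is almost surely the product of the \<open>m\<close> independent
  rotations that lie between the two steps.
\<close>
lemma expectation_step_correlation:
  assumes a: "0 < a" and "j \<ge> 1"
  shows "expectation (\<lambda>\<omega>. step (j + m) \<omega> * cnj (step j \<omega>)) = of_real (sin a / a) ^ m"
proof -
  let ?L = "{j<..j + m}"
  have L: "?L \<subseteq> {2..}" using \<open>j \<ge> 1\<close> by auto
  have rv: "\<Theta> l \<in> borel_measurable M" if "l \<in> ?L" for l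
    using measurable_angle[of l] L that by auto
  note rv[measurable]
  have indep: "indep_vars (\<lambda>_. borel) (\<lambda>l \<omega>. cis (\<Theta> l \<omega>)) ?L"
    using indep_vars_subset[OF angles_indep L] by (rule indep_vars_compose2) measurable
  have E1: "expectation (\<lambda>\<omega>. cis (\<Theta> l \<omega>)) = of_real (sin a / a)" if "l \<in> ?L" for l
  proof -
    have "expectation (\<lambda>\<omega>. cis (\<Theta> l \<omega>)) = (\<integral>x. cis x \<partial>distr M borel (\<Theta> l))"
      using rv[OF that] by (subst integral_distr) auto
    also have "distr M borel (\<Theta> l) = uniform_measure lborel {- a..a}"
      using angles_uniform[of l] L that by auto
    finally show ?thesis using integral_cis_symmetric_uniform[OF a] by simp
  qed
  have "AE \<omega> in M. step (j + m) \<omega> * cnj (step j \<omega>) = (\<Prod>l\<in>?L. cis (\<Theta> l \<omega>))"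
    using AE_norm_step
  proof eventually_elim
    case (elim \<omega>)
    then have "step j \<omega> * cnj (step j \<omega>) = 1"
      using \<open>j \<ge> 1\<close> by (simp add: complex_norm_square[symmetric])
    then show ?case by (simp add: walk_step_add[OF \<open>j \<ge> 1\<close>] mult.assoc)
  qed
  then have "expectation (\<lambda>\<omega>. step (j + m) \<omega> * cnj (step j \<omega>))
      = expectation (\<lambda>\<omega>. \<Prod>l\<in>?L. cis (\<Theta> l \<omega>))"
    by (intro integral_cong_AE) (auto intro!: borel_measurable_prod measurable_compose[OF rv])
  also have "\<dots> = (\<Prod>l\<in>?L. expectation (\<lambda>\<omega>. cis (\<Theta> l \<omega>)))"
    by (rule indep_vars_lebesgue_integral[OF _ indep])
      (auto intro!: integrable_const_bound[where B = 1] measurable_compose[OF rv])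
  also have "\<dots> = of_real (sin a / a) ^ m" using E1 by simp
  finally show ?thesis .
qed

lemma integrable_step_inner:
  assumes "j \<ge> 1" "k \<ge> 1"
  shows "integrable M (\<lambda>\<omega>. step j \<omega> \<bullet> step k \<omega>)"
proof (rule integrable_const_bound[where B = 1])
  show "AE \<omega> in M. norm (step j \<omega> \<bullet> step k \<omega>) \<le> 1"
    using AE_norm_step
  proof eventually_elim
    case (elim \<omega>)
    then show ?case using Cauchy_Schwarz_ineq2[of "step j \<omega>" "step k \<omega>"] assms by simp
  qed
qed measurable

text \<open>
  The exponent is \<open>\<bar>j - k\<bar>\<close>: with truncated subtraction one of the two summands is 0.
\<close>
lemma expectation_step_inner:
  assumes a: "0 < a" and "j \<ge> 1" "k \<ge> 1"
  shows "expectation (\<lambda>\<omega>. step j \<omega> \<bullet> step k \<omega>) = (sin a / a) ^ (j - k + (k - j))"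
proof -
  have le: "expectation (\<lambda>\<omega>. step k \<omega> \<bullet> step j \<omega>) = (sin a / a) ^ (k - j)"
    if "j \<le> k" "j \<ge> 1" for j k
  proof -
    obtain m where m: "k = j + m" using \<open>j \<le> k\<close> le_Suc_ex by blast
    have int: "integrable M (\<lambda>\<omega>. step k \<omega> * cnj (step j \<omega>))"
    proof (rule integrable_const_bound[where B = 1])
      show "AE \<omega> in M. norm (step k \<omega> * cnj (step j \<omega>)) \<le> 1"
        using AE_norm_step by eventually_elim (use that in \<open>simp add: norm_mult\<close>)
    qed measurable
    have "expectation (\<lambda>\<omega>. step k \<omega> \<bullet> step j \<omega>) = expectation (\<lambda>\<omega>. Re (step k \<omega> * cnj (step j \<omega>)))"
      by (simp add: inner_complex_def)
    also have "\<dots> = Re (expectation (\<lambda>\<omega>. step k \<omega> * cnj (step j \<omega>)))"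
      using int by (rule integral_Re)
    also have "\<dots> = (sin a / a) ^ (k - j)"
      unfolding m expectation_step_correlation[OF a \<open>j \<ge> 1\<close>]
      by (simp flip: of_real_power)
    finally show ?thesis .
  qed
  show ?thesis
    using le[of j k] le[of k j] assms by (cases "j \<le> k") (auto simp: inner_commute)
qed

text \<open>
  Expanding the square gives a double sum of \<open>\<rho> ^ \<bar>j - k\<bar>\<close>; each of the \<open>n\<close> rows is bounded by
  two geometric series, and \<open>1 - \<rho> \<ge> a\<^sup>2 / 10\<close>.
\<close>
lemma expectation_norm2_weighted_sum_le:
  assumes a: "0 < a" "a \<le> 1" and c: "\<And>j. 0 \<le> c j \<and> c j \<le> 1"
  shows "integrable M (\<lambda>\<omega>. (norm (\<Sum>j = 1..n. c j *\<^sub>R step j \<omega>))\<^sup>2)" (is "integrable M ?S")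
    and "expectation (\<lambda>\<omega>. (norm (\<Sum>j = 1..n. c j *\<^sub>R step j \<omega>))\<^sup>2) \<le> 20 * real n / a\<^sup>2"
proof -
  define \<rho> where "\<rho> = sin a / a"
  have "a \<le> pi" using a pi_gt3 by linarith
  have \<rho>: "0 \<le> \<rho>" "a\<^sup>2 / 10 \<le> 1 - \<rho>"
    unfolding \<rho>_def using sinc_bounds[OF a(1) \<open>a \<le> pi\<close>] a by auto
  moreover have "0 < a\<^sup>2 / 10" using a by simp
  ultimately have "\<rho> < 1" by linarith
  have S: "?S = (\<lambda>\<omega>. \<Sum>j = 1..n. \<Sum>k = 1..n. c j * (c k * (step j \<omega> \<bullet> step k \<omega>)))"
    by (simp add: power2_norm_eq_inner inner_sum_left inner_sum_right sum_distrib_left)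
      (simp add: inner_commute)
  have int: "integrable M (\<lambda>\<omega>. c j * (c k * (step j \<omega> \<bullet> step k \<omega>)))"
    if "j \<in> {1..n}" "k \<in> {1..n}" for j k
    using that by (intro integrable_mult_right integrable_step_inner) auto
  show "integrable M ?S"
    unfolding S by (intro Bochner_Integration.integrable_sum int)
  have "expectation ?S =
      (\<Sum>j = 1..n. expectation (\<lambda>\<omega>. \<Sum>k = 1..n. c j * (c k * (step j \<omega> \<bullet> step k \<omega>))))"
    unfolding S
    by (intro Bochner_Integration.integral_sum Bochner_Integration.integrable_sum int)
  also have "\<dots> =
      (\<Sum>j = 1..n. \<Sum>k = 1..n. expectation (\<lambda>\<omega>. c j * (c k * (step j \<omega> \<bullet> step k \<omega>))))"
    by (intro sum.cong refl Bochner_Integration.integral_sum int)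
  also have "\<dots> = (\<Sum>j = 1..n. \<Sum>k = 1..n. c j * (c k * \<rho> ^ (j - k + (k - j))))"
    by (intro sum.cong refl) (auto simp: expectation_step_inner[OF a(1)] \<rho>_def)
  also have "\<dots> \<le> (\<Sum>j = 1..n. \<Sum>k = 1..n. \<rho> ^ (j - k + (k - j)))"
  proof (intro sum_mono)
    fix j k
    have "c j * c k \<le> 1" using c by (simp add: mult_le_one)
    then show "c j * (c k * \<rho> ^ (j - k + (k - j))) \<le> \<rho> ^ (j - k + (k - j))"
      using mult_right_mono[of "c j * c k" 1 "\<rho> ^ (j - k + (k - j))"] \<rho>(1) by (simp add: mult.assoc)
  qed
  also have "\<dots> \<le> (\<Sum>j = 1..n. 2 / (1 - \<rho>))"
    by (intro sum_mono sum_power_distance_le \<rho> \<open>\<rho> < 1\<close>)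
  also have "\<dots> \<le> (\<Sum>j = 1..n. 2 / (a\<^sup>2 / 10))"
    by (intro sum_mono divide_left_mono[OF \<rho>(2)] mult_pos_pos \<open>0 < a\<^sup>2 / 10\<close>)
      (simp_all add: \<open>\<rho> < 1\<close>)
  also have "\<dots> = 20 * real n / a\<^sup>2" by simp
  finally show "expectation ?S \<le> 20 * real n / a\<^sup>2" .
qed

text \<open>
  The expectation is \<open>2 - 2 \<rho> ^ (j - 1)\<close>, which Bernoulli's inequality bounds by
  \<open>2 (j - 1) (1 - \<rho>)\<close>.
\<close>
lemma expectation_norm2_step_diff_start_le:
  assumes a: "0 < a" "a \<le> pi" and j: "j \<ge> 1" "j \<le> n"
  shows "integrable M (\<lambda>\<omega>. (norm (step j \<omega> - U1 \<omega>))\<^sup>2)" (is "integrable M ?D")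
    and "expectation (\<lambda>\<omega>. (norm (step j \<omega> - U1 \<omega>))\<^sup>2) \<le> real n * a\<^sup>2 / 3"
proof -
  define \<rho> where "\<rho> = sin a / a"
  have \<rho>: "0 \<le> \<rho>" "\<rho> \<le> 1" "1 - \<rho> \<le> a\<^sup>2 / 6"
    unfolding \<rho>_def using sinc_bounds[OF a] by auto
  have D: "?D = (\<lambda>\<omega>. step j \<omega> \<bullet> step j \<omega> + step 1 \<omega> \<bullet> step 1 \<omega> - 2 * (step j \<omega> \<bullet> step 1 \<omega>))"
    by (simp add: power2_norm_eq_inner inner_diff inner_commute)
  note int = integrable_step_inner[OF j(1) j(1)] integrable_step_inner[OF le_refl le_refl]
    integrable_step_inner[OF j(1) le_refl]
  show "integrable M ?D"
    unfolding D by (intro Bochner_Integration.integrable_diff Bochner_Integration.integrable_add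
        integrable_mult_right int)
  have "expectation ?D = 2 - 2 * \<rho> ^ (j - 1)"
    unfolding D using int j by (simp add: expectation_step_inner[OF a(1)] \<rho>_def del: walk_step.simps One_nat_def)
  also have "\<dots> \<le> 2 * (real (j - 1) * (1 - \<rho>))"
    using Bernoulli_inequality[of "\<rho> - 1" "j - 1"] \<rho> by (simp add: algebra_simps)
  also have "\<dots> \<le> 2 * (real n * (a\<^sup>2 / 6))"
    using \<rho> j by (intro mult_left_mono mult_mono) auto
  finally show "expectation ?D \<le> real n * a\<^sup>2 / 3" by simp
qed

end

section \<open>Uniform distance to the limit paths\<close>

context uniform_angles
begin

lemma measurable_polyline_walk: "(\<lambda>\<omega>. polyline n (\<lambda>j. step j \<omega>)) \<in> M \<rightarrow>\<^sub>M borel_of path_space"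
proof (rule measurable_compose[of "\<lambda>\<omega> j. step j \<omega>" M borel])
  show "(\<lambda>\<omega> j. step j \<omega>) \<in> borel_measurable M"
    by (rule measurable_coordinatewise_then_product) measurable
  show "polyline n \<in> borel \<rightarrow>\<^sub>M borel_of path_space"
    by (rule continuous_map_euclidean_measurable[OF continuous_map_polyline])
qed

text \<open>
  Markov's inequality for the square of the unscaled position, whose weights are the ramps at
  time \<open>t\<close>.
\<close>
lemma prob_polyline_ge:
  assumes a: "0 < a" "a \<le> 1" and n: "n \<ge> 1" and \<epsilon>: "0 < \<epsilon>" and t: "t \<in> {0..1}"
  defines "B \<equiv> {\<omega> \<in> space M. \<epsilon> \<le> norm (polyline n (\<lambda>j. step j \<omega>) t)}"
  shows "B \<in> events" and "prob B \<le> 20 / \<epsilon>\<^sup>2 / (real n * a\<^sup>2)"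
proof -
  let ?S = "\<lambda>\<omega>. (norm (\<Sum>j = 1..n. ramp n j t *\<^sub>R step j \<omega>))\<^sup>2"
  have c: "0 < (real n * \<epsilon>)\<^sup>2" using n \<epsilon> by simp
  have "\<epsilon> \<le> norm (polyline n x t) \<longleftrightarrow>
      (real n * \<epsilon>)\<^sup>2 \<le> (norm (\<Sum>j = 1..n. ramp n j t *\<^sub>R x j))\<^sup>2" for x
  proof -
    have "\<epsilon> \<le> norm (polyline n x t) \<longleftrightarrow> real n * \<epsilon> \<le> norm (\<Sum>j = 1..n. ramp n j t *\<^sub>R x j)"
      using t n by (simp add: polyline_def field_simps)
    also have "\<dots> \<longleftrightarrow> (real n * \<epsilon>)\<^sup>2 \<le> (norm (\<Sum>j = 1..n. ramp n j t *\<^sub>R x j))\<^sup>2"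
      using \<epsilon> by (intro power_mono_iff[symmetric]) auto
    finally show ?thesis .
  qed
  then have B: "B = {\<omega> \<in> space M. (real n * \<epsilon>)\<^sup>2 \<le> ?S \<omega>}" by (simp add: B_def)
  show "B \<in> events" unfolding B by measurable
  have "prob B \<le> expectation ?S / (real n * \<epsilon>)\<^sup>2"
    unfolding B using expectation_norm2_weighted_sum_le(1)[OF a] ramp_bounds c
    by (intro integral_Markov_inequality_measure[where A = "{}"]) auto
  also have "\<dots> \<le> (20 * real n / a\<^sup>2) / (real n * \<epsilon>)\<^sup>2"
    using expectation_norm2_weighted_sum_le(2)[OF a] ramp_bounds c
    by (intro divide_right_mono) auto
  also have "\<dots> = 20 / \<epsilon>\<^sup>2 / (real n * a\<^sup>2)"
    using n by (simp add: power_mult_distrib power2_eq_square)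
  finally show "prob B \<le> 20 / \<epsilon>\<^sup>2 / (real n * a\<^sup>2)" .
qed

text \<open>
  The union bound over the \<open>m + 1\<close> grid points. The null set covers starting points off the unit
  circle, for which the path may fail to be 1-Lipschitz.
\<close>
lemma polyline_near_zero:
  assumes n: "n \<ge> 1" and \<epsilon>: "0 < \<epsilon>" and m: "m > 0"
  defines "B \<equiv> (\<Union>i\<le>m. {\<omega> \<in> space M. \<epsilon> \<le> norm (polyline n (\<lambda>j. step j \<omega>) (real i / real m))})"
  shows "B \<in> events"
    and "AE \<omega> in M. \<omega> \<notin> B \<longrightarrow>
      mdist path_metric (\<lambda>t\<in>{0..1}. 0) (polyline n (\<lambda>j. step j \<omega>)) \<le> \<epsilon> + 1 / real m"
    and "0 < a \<Longrightarrow> a \<le> 1 \<Longrightarrow> prob B \<le> (real m + 1) * (20 / \<epsilon>\<^sup>2 / (real n * a\<^sup>2))"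
proof -
  let ?B = "\<lambda>i. {\<omega> \<in> space M. \<epsilon> \<le> norm (polyline n (\<lambda>j. step j \<omega>) (real i / real m))}"
  have meas: "?B i \<in> events" if "i \<le> m" for i
    using that by (simp add: polyline_def divide_le_eq_1)
  then show "B \<in> events" unfolding B_def by auto
  show "AE \<omega> in M. \<omega> \<notin> B \<longrightarrow>
      mdist path_metric (\<lambda>t\<in>{0..1}. 0) (polyline n (\<lambda>j. step j \<omega>)) \<le> \<epsilon> + 1 / real m"
    using AE_norm_step AE_space
  proof eventually_elim
    case (elim \<omega>)
    show ?case
      by (intro impI mdist_zero_polyline_le) (use elim m in \<open>auto simp: B_def not_le less_imp_le\<close>)
  qed
  assume a: "0 < a" "a \<le> 1"
  have "prob B \<le> (\<Sum>i\<le>m. prob (?B i))"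
    unfolding B_def by (rule finite_measure_subadditive_finite) (use meas in auto)
  also have "\<dots> \<le> (\<Sum>i\<le>m. 20 / \<epsilon>\<^sup>2 / (real n * a\<^sup>2))"
    by (intro sum_mono prob_polyline_ge(2)[OF a n \<epsilon>]) (use m in auto)
  finally show "prob B \<le> (real m + 1) * (20 / \<epsilon>\<^sup>2 / (real n * a\<^sup>2))" by (simp add: algebra_simps)
qed

text \<open>
  The exceptional event comes from Markov's inequality for the mean \<open>V\<close> of the squared deviations
  from the first step. By the Cauchy-Schwarz inequality \<open>V\<close> dominates the square of the mean
  deviation, which bounds the uniform distance: the ray is the polyline all of whose steps are \<open>U1\<close>.
\<close>
lemma polyline_near_ray:
  assumes a: "0 < a" "a \<le> pi" and n: "n \<ge> 1" and \<epsilon>: "0 < \<epsilon>"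
  shows "\<exists>B\<in>events. prob B \<le> real n * a\<^sup>2 / (3 * \<epsilon>\<^sup>2) \<and>
    (\<forall>\<omega>\<in>space M - B. mdist path_metric (\<lambda>t\<in>{0..1}. t *\<^sub>R U1 \<omega>) (polyline n (\<lambda>j. step j \<omega>)) < \<epsilon>)"
proof -
  define V where "V \<omega> = (\<Sum>j = 1..n. (norm (step j \<omega> - U1 \<omega>))\<^sup>2) / real n" for \<omega>
  have int: "integrable M V"
    unfolding V_def using expectation_norm2_step_diff_start_le(1)[OF a]
    by (intro integrable_divide_zero Bochner_Integration.integrable_sum) auto
  have V_nonneg: "0 \<le> V \<omega>" for \<omega> by (simp add: V_def sum_nonneg)
  from int have [measurable]: "V \<in> borel_measurable M" by auto
  have "expectation V = (\<Sum>j = 1..n. expectation (\<lambda>\<omega>. (norm (step j \<omega> - U1 \<omega>))\<^sup>2)) / real n"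
    unfolding V_def using expectation_norm2_step_diff_start_le(1)[OF a]
    by (subst integral_divide_zero, subst Bochner_Integration.integral_sum) auto
  also have "\<dots> \<le> (\<Sum>j = 1..n. real n * a\<^sup>2 / 3) / real n"
    by (intro divide_right_mono sum_mono expectation_norm2_step_diff_start_le(2)[OF a]) auto
  also have "\<dots> = real n * a\<^sup>2 / 3" using n by simp
  finally have EV: "expectation V \<le> real n * a\<^sup>2 / 3" .
  define B where "B = {\<omega> \<in> space M. \<epsilon>\<^sup>2 \<le> V \<omega>}"
  show ?thesis
  proof (intro bexI[of _ B] conjI ballI)
    show "B \<in> events" unfolding B_def by measurable
    have "prob B \<le> expectation V / \<epsilon>\<^sup>2"
      unfolding B_def using int \<epsilon> V_nonneg
      by (intro integral_Markov_inequality_measure[where A = "{}"]) auto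
    also have "\<dots> \<le> (real n * a\<^sup>2 / 3) / \<epsilon>\<^sup>2" using EV by (intro divide_right_mono) auto
    finally show "prob B \<le> real n * a\<^sup>2 / (3 * \<epsilon>\<^sup>2)" by simp
    fix \<omega> assume "\<omega> \<in> space M - B"
    then have "V \<omega> < \<epsilon>\<^sup>2" by (auto simp: B_def)
    let ?D = "(\<Sum>j = 1..n. norm (step j \<omega> - U1 \<omega>)) / real n"
    have "?D\<^sup>2 \<le> ((\<Sum>j = 1..n. (norm (step j \<omega> - U1 \<omega>))\<^sup>2) * real n) / (real n)\<^sup>2"
      using sum_squared_le_sum_of_squares[of "\<lambda>j. norm (step j \<omega> - U1 \<omega>)" "{1..n}"]
      by (simp add: power_divide divide_right_mono)
    also have "\<dots> = V \<omega>" using n by (simp add: V_def power2_eq_square)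
    finally have "?D\<^sup>2 < \<epsilon>\<^sup>2" using \<open>V \<omega> < \<epsilon>\<^sup>2\<close> by simp
    then have "?D < \<epsilon>" using \<epsilon> by (simp add: power_less_imp_less_base)
    moreover have "mdist path_metric (polyline n (\<lambda>_. U1 \<omega>)) (polyline n (\<lambda>j. step j \<omega>)) \<le> ?D"
      using mdist_polyline_le[of n "\<lambda>_. U1 \<omega>" "\<lambda>j. step j \<omega>"] by (simp add: norm_minus_commute)
    ultimately show "mdist path_metric (\<lambda>t\<in>{0..1}. t *\<^sub>R U1 \<omega>) (polyline n (\<lambda>j. step j \<omega>)) < \<epsilon>"
      by (simp add: polyline_const[OF n])
  qed
qed

end

section \<open>The two regimes\<close>

theorem proposition3:
  fixes \<alpha> :: "nat \<Rightarrow> real"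
    and M :: "nat \<Rightarrow> 'a measure"
    and U1 :: "nat \<Rightarrow> 'a \<Rightarrow> complex"
    and \<Theta> :: "nat \<Rightarrow> nat \<Rightarrow> 'a \<Rightarrow> real"
    and X :: "nat \<Rightarrow> 'a \<Rightarrow> real \<Rightarrow> complex"
  assumes alpha_range: "\<And>n. n \<ge> 1 \<Longrightarrow> 0 < \<alpha> n \<and> \<alpha> n \<le> pi"
    and alpha_lim: "\<alpha> \<longlonglongrightarrow> 0"
    and model: "\<And>n. n \<ge> 1 \<Longrightarrow> uniform_angles (M n) (\<alpha> n) (U1 n) (\<Theta> n)"
    and X_def: "\<And>n \<omega> t. X n \<omega> t = walk n (U1 n \<omega>) (\<lambda>j. \<Theta> n j \<omega>) t"
  shows
    "(filterlim (\<lambda>n. real n * (\<alpha> n)\<^sup>2) at_top sequentially \<longrightarrow>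
        converges_in_law path_space M (\<lambda>n \<omega>. \<lambda>t\<in>{0..1}. (1 / real n) *\<^sub>R X n \<omega> t)
          (return (borel_of path_space) (\<lambda>t\<in>{0..1}. 0))) \<and>
     ((\<lambda>n. real n * (\<alpha> n)\<^sup>2) \<longlonglongrightarrow> 0 \<longrightarrow>
        (\<forall>(N :: 'b measure) U.
           prob_space N \<and> U \<in> borel_measurable N \<and> distr N borel U = uniform_circle \<longrightarrow>
           converges_in_law path_space M (\<lambda>n \<omega>. \<lambda>t\<in>{0..1}. (1 / real n) *\<^sub>R X n \<omega> t)
             (distr N (borel_of path_space) (\<lambda>\<omega>. \<lambda>t\<in>{0..1}. t *\<^sub>R U \<omega>))))"
proof (intro conjI impI allI)
  let ?Y = "\<lambda>n \<omega>. \<lambda>t\<in>{0..1}. (1 / real n) *\<^sub>R X n \<omega> t"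
  have Y: "?Y n \<omega> = polyline n (\<lambda>j. walk_step (U1 n \<omega>) (\<lambda>i. \<Theta> n i \<omega>) j)" for n \<omega>
    by (simp only: X_def rescaled_walk_eq_polyline)
  have prob: "prob_space (M n)" if "n \<ge> 1" for n
    using model[OF that] by (simp add: uniform_angles_def)
  have Y_meas: "?Y n \<in> M n \<rightarrow>\<^sub>M borel_of (mtopology_of path_metric)" if "n \<ge> 1" for n
    unfolding Y path_space_eq[symmetric] by (rule uniform_angles.measurable_polyline_walk[OF model[OF that]])
  have ray_meas: "(\<lambda>u. \<lambda>t\<in>{0..1}. t *\<^sub>R u) \<in> borel \<rightarrow>\<^sub>M borel_of (mtopology_of path_metric)"
    using continuous_map_euclidean_measurable[OF continuous_map_ray] by (simp add: path_space_eq)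
  {
    assume diverges: "filterlim (\<lambda>n. real n * (\<alpha> n)\<^sup>2) at_top sequentially"
    let ?z = "(\<lambda>t\<in>{0..1}. 0) :: real \<Rightarrow> complex"
    have z: "?z \<in> topspace (mtopology_of path_metric)"
      using polyline_in_mspace[of 1 "\<lambda>_. 0"] by (simp add: polyline_const)
    show "converges_in_law path_space M ?Y (return (borel_of path_space) ?z)"
      unfolding path_space_eq
    proof (rule converges_in_law_by_coupling[where Z = "\<lambda>_ _. ?z" and K = "{?z}"])
      fix \<epsilon> :: real assume "0 < \<epsilon>"
      then obtain k where k: "1 / real (Suc k) < \<epsilon> / 2"
        using nat_approx_posE[of "\<epsilon> / 2"] by (metis half_gt_zero)
      \<comment> \<open>Half of \<open>\<epsilon>\<close> pays for the mesh of the grid, half for the size at the grid points.\<close>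
      define m where "m = Suc k"
      define \<eta> where "\<eta> = \<epsilon> / 2"
      have m: "m > 0" "1 / real m < \<epsilon> / 2" and \<eta>: "0 < \<eta>" using k \<open>0 < \<epsilon>\<close> by (auto simp: m_def \<eta>_def)
      define B where "B n = (\<Union>i\<le>m. {\<omega> \<in> space (M n). \<eta> \<le> norm (polyline n
        (\<lambda>j. walk_step (U1 n \<omega>) (\<lambda>i. \<Theta> n i \<omega>) j) (real i / real m))})" for n
      have near: "B n \<in> sets (M n)" "AE \<omega> in M n. \<omega> \<notin> B n \<longrightarrow> mdist path_metric ?z (?Y n \<omega>) < \<epsilon>"
        if n: "n \<ge> 1" for n
      proof -
        interpret uniform_angles "M n" "\<alpha> n" "U1 n" "\<Theta> n" using model[OF n] .
        show "B n \<in> sets (M n)" unfolding B_def by (rule polyline_near_zero(1)[OF n \<eta> m(1)])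
        show "AE \<omega> in M n. \<omega> \<notin> B n \<longrightarrow> mdist path_metric ?z (?Y n \<omega>) < \<epsilon>"
          using polyline_near_zero(2)[OF n \<eta> m(1)] unfolding B_def[symmetric] Y
          by eventually_elim (use m in \<open>auto simp: \<eta>_def\<close>)
      qed
      have "(\<lambda>n. measure (M n) (B n)) \<longlonglongrightarrow> 0"
      proof (rule tendsto_sandwich[OF _ _ tendsto_const])
        show "\<forall>\<^sub>F n in sequentially. 0 \<le> measure (M n) (B n)" by simp
        have "\<forall>\<^sub>F n in sequentially. \<alpha> n < 1" using alpha_lim by (rule order_tendstoD) simp
        then show "\<forall>\<^sub>F n in sequentially. measure (M n) (B n)
            \<le> (real m + 1) * (20 / \<eta>\<^sup>2 / (real n * (\<alpha> n)\<^sup>2))"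
          using eventually_ge_at_top[of 1]
        proof eventually_elim
          case (elim n)
          interpret uniform_angles "M n" "\<alpha> n" "U1 n" "\<Theta> n" using model[OF elim(2)] .
          show ?case unfolding B_def
            using polyline_near_zero(3)[OF elim(2) \<eta> m(1)] elim alpha_range[of n] by simp
        qed
        have "(\<lambda>n. 20 / \<eta>\<^sup>2 / (real n * (\<alpha> n)\<^sup>2)) \<longlonglongrightarrow> 0"
          using diverges by (intro tendsto_divide_0[OF tendsto_const] filterlim_at_top_imp_at_infinity)
        then show "(\<lambda>n. (real m + 1) * (20 / \<eta>\<^sup>2 / (real n * (\<alpha> n)\<^sup>2))) \<longlonglongrightarrow> 0"
          by (rule tendsto_mult_right_zero)
      qed
      with near show "\<exists>B. (\<forall>n\<ge>1. B n \<in> sets (M n) \<and>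
          (AE \<omega> in M n. \<omega> \<notin> B n \<longrightarrow> mdist path_metric ?z (?Y n \<omega>) < \<epsilon>)) \<and>
          (\<lambda>n. measure (M n) (B n)) \<longlonglongrightarrow> 0" by blast
    next
      show "distr (M n) (borel_of (mtopology_of path_metric)) (\<lambda>_. ?z)
          = return (borel_of (mtopology_of path_metric)) ?z" if "n \<ge> 1" for n
        by (rule prob_space.distr_const[OF prob[OF that]]) (use z in simp)
    qed (use z prob Y_meas in auto)
  }
  {
    fix N :: "'b measure" and U
    assume vanishes: "(\<lambda>n. real n * (\<alpha> n)\<^sup>2) \<longlonglongrightarrow> 0"
      and "prob_space N \<and> U \<in> borel_measurable N \<and> distr N borel U = uniform_circle"
    then have U: "U \<in> borel_measurable N" "distr N borel U = uniform_circle" by auto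
    let ?ray = "\<lambda>u::complex. \<lambda>t\<in>{0..1}. t *\<^sub>R u"
    show "converges_in_law path_space M ?Y (distr N (borel_of path_space) (\<lambda>\<omega>. ?ray (U \<omega>)))"
      unfolding path_space_eq
    proof (rule converges_in_law_by_coupling[where Z = "\<lambda>n \<omega>. ?ray (U1 n \<omega>)" and K = "?ray ` sphere 0 1"])
      show "compactin (mtopology_of path_metric) (?ray ` sphere 0 1)"
        using continuous_map_ray unfolding path_space_eq
        by (rule image_compactin[rotated]) simp
      fix n :: nat assume n: "n \<ge> 1"
      interpret uniform_angles "M n" "\<alpha> n" "U1 n" "\<Theta> n" using model[OF n] .
      show "(\<lambda>\<omega>. ?ray (U1 n \<omega>)) \<in> M n \<rightarrow>\<^sub>M borel_of (mtopology_of path_metric)"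
        using start_measurable ray_meas by (rule measurable_compose)
      show "AE \<omega> in M n. ?ray (U1 n \<omega>) \<in> ?ray ` sphere 0 1"
        using AE_norm_start by eventually_elim simp
      show "distr (M n) (borel_of (mtopology_of path_metric)) (\<lambda>\<omega>. ?ray (U1 n \<omega>))
          = distr N (borel_of (mtopology_of path_metric)) (\<lambda>\<omega>. ?ray (U \<omega>))"
        using distr_distr[OF ray_meas start_measurable] distr_distr[OF ray_meas U(1)] start_uniform U(2)
        by (simp add: o_def)
    next
      fix \<epsilon> :: real assume \<epsilon>: "0 < \<epsilon>"
      \<comment> \<open>The guard makes the choice of \<open>B\<close> total; nothing is known about stage 0.\<close>
      have "\<exists>B. n \<ge> 1 \<longrightarrow> B \<in> sets (M n) \<and> measure (M n) B \<le> real n * (\<alpha> n)\<^sup>2 / (3 * \<epsilon>\<^sup>2) \<and>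
          (\<forall>\<omega>\<in>space (M n) - B. mdist path_metric (?ray (U1 n \<omega>)) (?Y n \<omega>) < \<epsilon>)" for n
      proof (cases "n \<ge> 1")
        case True
        interpret uniform_angles "M n" "\<alpha> n" "U1 n" "\<Theta> n" using model[OF True] .
        show ?thesis
          unfolding Y using polyline_near_ray[OF _ _ True \<epsilon>] alpha_range[OF True] by blast
      qed simp
      then obtain B where B: "\<And>n. n \<ge> 1 \<Longrightarrow> B n \<in> sets (M n)"
          "\<And>n. n \<ge> 1 \<Longrightarrow> measure (M n) (B n) \<le> real n * (\<alpha> n)\<^sup>2 / (3 * \<epsilon>\<^sup>2)"
          "\<And>n \<omega>. n \<ge> 1 \<Longrightarrow> \<omega> \<in> space (M n) - B n \<Longrightarrow>
            mdist path_metric (?ray (U1 n \<omega>)) (?Y n \<omega>) < \<epsilon>"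
        by metis
      have "(\<lambda>n. measure (M n) (B n)) \<longlonglongrightarrow> 0"
      proof (rule tendsto_sandwich[OF _ _ tendsto_const])
        show "\<forall>\<^sub>F n in sequentially. 0 \<le> measure (M n) (B n)" by simp
        show "\<forall>\<^sub>F n in sequentially. measure (M n) (B n) \<le> real n * (\<alpha> n)\<^sup>2 / (3 * \<epsilon>\<^sup>2)"
          using eventually_ge_at_top[of 1] by eventually_elim (rule B(2))
        show "(\<lambda>n. real n * (\<alpha> n)\<^sup>2 / (3 * \<epsilon>\<^sup>2)) \<longlonglongrightarrow> 0"
          using vanishes by (rule tendsto_divide_zero)
      qed
      moreover have "AE \<omega> in M n. \<omega> \<notin> B n \<longrightarrow> mdist path_metric (?ray (U1 n \<omega>)) (?Y n \<omega>) < \<epsilon>"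
        if "n \<ge> 1" for n
        using B(3)[OF that] by (intro AE_I2) auto
      ultimately show "\<exists>B. (\<forall>n\<ge>1. B n \<in> sets (M n) \<and>
          (AE \<omega> in M n. \<omega> \<notin> B n \<longrightarrow> mdist path_metric (?ray (U1 n \<omega>)) (?Y n \<omega>) < \<epsilon>)) \<and>
          (\<lambda>n. measure (M n) (B n)) \<longlonglongrightarrow> 0"
        using B(1) by blast
    qed (use prob Y_meas in auto)
  }
qed

end
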